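(* Let $G=(V,E)$ be a finite connected simple graph with $n\ge2$ vertices, maximum degree $\Delta$, and diameter $D$. There exists $f_0\in[-1,1]^V$ such that, for every $0<\epsilon\le1$, $$\mathbb{E}\,\tau_\infty(\epsilon;f_0)\ \ge\ \frac{1}{16e\pi^2}\,\frac{nD^2}{\Delta}.$$
   Context: Dynamics at $p=\infty$ (midrange rule): a profile is a function $f:V\to\mathbb{R}$. For $u\in V$, $f^{\#u}$ is the profile equal to $\frac12\bigl(\max_{v\sim u}f(v)+\min_{v\sim u}f(v)\bigr)$ at $u$ and equal to $f$ at every other vertex. Let $U_1,U_2,\ldots$ be independent uniformly distributed vertices of $V$; starting from a deterministic profile $f_0$ set $f_t=f_{t-1}^{\#U_t}$ for $t\ge1$. Let $\operatorname{osc}(f)=\max_V f-\min_V f$ and $\tau_\infty(\epsilon;f_0)=\min\{t\ge0:\operatorname{osc}(f_t)\le\epsilon\}$ (equal to $\infty$ if the set is empty). $\mathbb{E}$ is expectation over $(U_t)$. The diameter is with respect to the edge-count graph distance. *)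

theory Defs
  imports "HOL-Probability.Probability" "Graph_Theory.Graph_Theory"
begin

text \<open>
  A finite simple graph is an instance of the locale \<^locale>\<open>graph\<close>: every undirected edge is
  represented by its two opposite arcs, so the degree of a vertex is its out-degree, and the
  number of edges traversed by a walk is the length of its list of arcs.
\<close>

definition neighbours :: "('a, 'b) pre_digraph \<Rightarrow> 'a \<Rightarrow> 'a set" where
  "neighbours G u = {v. u \<rightarrow>\<^bsub>G\<^esub> v}"

definition max_degree :: "('a, 'b) pre_digraph \<Rightarrow> nat" where
  "max_degree G = Max (out_degree G ` verts G)"

definition graph_dist :: "('a, 'b) pre_digraph \<Rightarrow> 'a \<Rightarrow> 'a \<Rightarrow> nat" where
  "graph_dist G u v = (LEAST k. \<exists>p. pre_digraph.awalk G u p v \<and> length p = k)"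

definition graph_diameter :: "('a, 'b) pre_digraph \<Rightarrow> nat" where
  "graph_diameter G = Max {graph_dist G u v |u v. u \<in> verts G \<and> v \<in> verts G}"

text \<open>
  A profile is a function on the whole vertex type; only its values on \<^term>\<open>verts G\<close> matter.
\<close>

definition midrange_update :: "('a, 'b) pre_digraph \<Rightarrow> 'a \<Rightarrow> ('a \<Rightarrow> real) \<Rightarrow> 'a \<Rightarrow> real" where
  "midrange_update G u f =
     f(u := (Max (f ` neighbours G u) + Min (f ` neighbours G u)) / 2)"

definition osc :: "('a, 'b) pre_digraph \<Rightarrow> ('a \<Rightarrow> real) \<Rightarrow> real" where
  "osc G f = Max (f ` verts G) - Min (f ` verts G)"

text \<open>
  The profile at time \<open>t\<close> uses the vertices \<open>u 1, \<dots>, u t\<close>; the value \<open>u 0\<close> is never used.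
\<close>

primrec midrange_process ::
    "('a, 'b) pre_digraph \<Rightarrow> ('a \<Rightarrow> real) \<Rightarrow> (nat \<Rightarrow> 'a) \<Rightarrow> nat \<Rightarrow> 'a \<Rightarrow> real" where
  "midrange_process G f\<^sub>0 u 0 = f\<^sub>0"
| "midrange_process G f\<^sub>0 u (Suc t) =
     midrange_update G (u (Suc t)) (midrange_process G f\<^sub>0 u t)"

text \<open>In \<^typ>\<open>enat\<close>, the infimum of the empty set is \<open>\<infinity>\<close>.\<close>

definition hitting_time ::
    "('a, 'b) pre_digraph \<Rightarrow> real \<Rightarrow> ('a \<Rightarrow> real) \<Rightarrow> (nat \<Rightarrow> 'a) \<Rightarrow> enat" where
  "hitting_time G \<epsilon> f\<^sub>0 u = Inf (enat ` {t. osc G (midrange_process G f\<^sub>0 u t) \<le> \<epsilon>})"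

definition iid_uniform_vertices ::
    "('a, 'b) pre_digraph \<Rightarrow> 'w measure \<Rightarrow> (nat \<Rightarrow> 'w \<Rightarrow> 'a) \<Rightarrow> bool" where
  "iid_uniform_vertices G M U \<longleftrightarrow>
     prob_space M \<and>
     prob_space.indep_vars M (\<lambda>_. count_space (verts G)) U {1..} \<and>
     (\<forall>t\<ge>1. distr M (count_space (verts G)) (U t) = uniform_count_measure (verts G))"

end

theory Submission
  imports Defs
begin

text \<open>
  Write \<open>D\<close> for the diameter, \<open>\<Delta>\<close> for the maximum degree, \<open>n\<close> for the number of vertices, and
  \<open>d\<close> for the distance, and let \<open>x, y\<close> be vertices with \<open>d x y = D\<close>. The lower bound compares two
  effects: the dynamics needs about \<open>D\<^sup>2\<close> successive local averagings to bring the values at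
  \<open>x\<close> and \<open>y\<close> together, and successive averagings become available only at rate about \<open>\<Delta> / n\<close>.

  The first effect is a discrete heat-equation estimate. At a vertex \<open>v\<close> with \<open>d x v = i \<ge> 1\<close> some
  neighbour has distance \<open>i - 1\<close> to \<open>x\<close> and every neighbour has distance at most \<open>i + 1\<close>. Since
  \<open>((i - 1)\<^sup>2 + (i + 1)\<^sup>2) / 2 = i\<^sup>2 + 1\<close>, a bound \<open>f v \<le> b + c (d x v)\<^sup>2\<close> deteriorates by at most
  \<open>c\<close> with each update, as long as only updates that feed into each other are counted. So
  \<open>f\<^sub>t v \<le> b + c ((d x v)\<^sup>2 + K\<^sub>t v)\<close>, where \<open>K\<^sub>t v\<close> is the length of the longest chain of
  updates along a walk that ends with an update at \<open>v\<close>. Reflection gives a lower bound around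
  \<open>y\<close>. With \<open>c = 4 / D\<^sup>2\<close> one profile satisfies both bounds initially, the upper one with
  \<open>b = - 1\<close> and the lower one with \<open>b = 1\<close>, so that the oscillation exceeds \<open>1\<close> while
  \<open>K\<^sub>t x + K\<^sub>t y < D\<^sup>2 / 4\<close>.

  For the second effect, \<open>K\<^sub>t\<close> is replaced by \<open>ln W\<^sub>t\<close>, where \<open>W\<^sub>t\<close> is the sum of \<open>e\<^sup>k\<close> over all
  chains, \<open>k\<close> being the length. This logarithm dominates \<open>K\<^sub>t\<close>, and \<open>W\<^sub>t\<close> evolves linearly,
  so independence of the updated vertices gives \<open>E W\<^sub>t \<le> (1 + e \<Delta> / n)\<^sup>t\<close>
  (\<open>expectation_chain_weight_le\<close>). By Markov's inequality \<open>W\<^sub>t x + W\<^sub>t y\<close> stays below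
  \<open>2 exp (D\<^sup>2 / 8)\<close> with probability at least \<open>1 / 2\<close> when \<open>e \<Delta> t / n \<le> D\<^sup>2 / 16\<close>. On this event
  \<open>ln (W\<^sub>t x) + ln (W\<^sub>t y) < D\<^sup>2 / 4\<close>, by the inequality of arithmetic and geometric means, and hence
  \<open>\<tau> > t\<close>. Taking \<open>t\<close> as large as possible yields \<open>E \<tau> \<ge> n D\<^sup>2 / (32 e \<Delta>)\<close>, and
  \<open>2 \<le> \<pi>\<^sup>2\<close> finishes the proof.
\<close>

section \<open>Neighbours and distances\<close>

locale connected_graph = graph G for G :: "('a, 'b) pre_digraph" (structure) +
  assumes conn: "Digraph_Component.connected G"
    and two_vertices: "card (verts G) \<ge> 2"
begin

lemma neighbours_sym: "v \<in> neighbours G u \<longleftrightarrow> u \<in> neighbours G v"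
  using arcs_ends_symmetric[OF sym_arcs] by (auto simp: neighbours_def)

lemma neighbours_subset: "neighbours G u \<subseteq> verts G"
  by (auto simp: neighbours_def arcs_ends_conv)

lemma finite_neighbours: "finite (neighbours G u)"
  using neighbours_subset finite_verts by (rule finite_subset)

lemma neighbours_conv_out_arcs: "neighbours G u = head G ` out_arcs G u"
  by (auto simp: neighbours_def arcs_ends_conv out_arcs_def)

lemma card_neighbours_le:
  assumes "u \<in> verts G"
  shows "card (neighbours G u) \<le> max_degree G"
proof -
  have "finite (out_arcs G u)"
    by (rule finite_subset[OF _ finite_arcs]) (auto simp: out_arcs_def)
  then have "card (neighbours G u) \<le> out_degree G u"
    unfolding neighbours_conv_out_arcs out_degree_def by (rule card_image_le)
  also have "\<dots> \<le> max_degree G"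
    unfolding max_degree_def using assms by (intro Max_ge) auto
  finally show ?thesis .
qed

lemma ex_awalk:
  assumes "u \<in> verts G" "v \<in> verts G"
  shows "\<exists>p. awalk u p v"
  using symmetric_connected_imp_strongly_connected[OF sym_arcs conn] assms
  by (auto simp: strongly_connected_def reachable_awalk)

lemma neighbours_nonempty:
  assumes "u \<in> verts G"
  shows "neighbours G u \<noteq> {}"
proof -
  have "verts G \<noteq> {u}"
    using two_vertices by auto
  then obtain w where w: "w \<in> verts G" "w \<noteq> u"
    using assms by blast
  obtain p where "awalk u p w"
    using ex_awalk assms w by blast
  with w obtain e q where "p = e # q" "e \<in> arcs G" "tail G e = u"
    by (cases p) (auto simp: awalk_simps)
  then show ?thesis
    by (auto simp: neighbours_conv_out_arcs out_arcs_def)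
qed

lemma graph_dist_le: "awalk u p v \<Longrightarrow> graph_dist G u v \<le> length p"
  unfolding graph_dist_def by (rule Least_le) blast

lemma ex_shortest_awalk:
  assumes "u \<in> verts G" "v \<in> verts G"
  obtains p where "awalk u p v" "length p = graph_dist G u v"
proof -
  obtain p where "awalk u p v"
    using ex_awalk assms by blast
  then have "\<exists>k p. awalk u p v \<and> length p = k"
    by blast
  then have "\<exists>p. awalk u p v \<and> length p = graph_dist G u v"
    unfolding graph_dist_def by (rule LeastI_ex)
  with that show ?thesis by blast
qed

lemma graph_dist_refl: "u \<in> verts G \<Longrightarrow> graph_dist G u u = 0"
  using graph_dist_le[of u "[]" u] by (simp add: awalk_simps)

lemma graph_dist_triangle:
  assumes "u \<in> verts G" "v \<in> verts G" "w \<in> verts G"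
  shows "graph_dist G u w \<le> graph_dist G u v + graph_dist G v w"
proof -
  obtain p where p: "awalk u p v" "length p = graph_dist G u v"
    using ex_shortest_awalk assms(1,2) by blast
  obtain q where q: "awalk v q w" "length q = graph_dist G v w"
    using ex_shortest_awalk assms(2,3) by blast
  show ?thesis
    using graph_dist_le[OF awalk_appendI[OF p(1) q(1)]] p q by simp
qed

lemma graph_dist_neighbour:
  assumes "v \<in> neighbours G u"
  shows "graph_dist G u v \<le> 1"
proof -
  obtain e where "e \<in> arcs G" "tail G e = u" "head G e = v"
    using assms by (auto simp: neighbours_def arcs_ends_conv)
  then show ?thesis
    using graph_dist_le[OF arc_implies_awalk, of e] by simp
qed

lemma graph_dist_step:
  assumes "x \<in> verts G" "v \<in> neighbours G u"
  shows "graph_dist G x v \<le> graph_dist G x u + 1"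
proof -
  have "u \<in> verts G" "v \<in> verts G"
    using assms neighbours_subset neighbours_sym by blast+
  then show ?thesis
    using graph_dist_triangle[of x u v] graph_dist_neighbour[OF assms(2)] assms(1) by simp
qed

lemma ex_neighbour_closer:
  assumes "x \<in> verts G" "u \<in> verts G" "u \<noteq> x"
  shows "\<exists>w\<in>neighbours G u. graph_dist G x u = graph_dist G x w + 1"
proof -
  obtain p where p: "awalk x p u" "length p = graph_dist G x u"
    using ex_shortest_awalk assms by blast
  with assms(3) have "p \<noteq> []"
    by (auto simp: awalk_simps)
  then obtain q e where pq: "p = q @ [e]"
    by (metis rev_exhaust)
  with p have q: "awalk x q (tail G e)" and e: "e \<in> arcs G" "head G e = u"
    by (auto simp: awalk_simps)
  have w: "tail G e \<in> neighbours G u"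
    using e neighbours_sym[of u "tail G e"] by (auto simp: neighbours_def arcs_ends_conv)
  have "graph_dist G x (tail G e) + 1 \<le> graph_dist G x u"
    using graph_dist_le[OF q] p pq by simp
  moreover have "graph_dist G x u \<le> graph_dist G x (tail G e) + 1"
    using graph_dist_step[OF assms(1)] w neighbours_sym by blast
  ultimately show ?thesis
    using w by force
qed

text \<open>
  Induction along a geodesic from \<open>u\<close>; the neighbour relation is symmetric, so each of its steps can be
  taken backwards. Applied in both directions, this is the symmetry of the distance.
\<close>

lemma graph_dist_sym_le:
  assumes "u \<in> verts G" "v \<in> verts G"
  shows "graph_dist G v u \<le> graph_dist G u v"
  using assms(2)
proof (induction "graph_dist G u v" arbitrary: v rule: less_induct)
  case less
  show ?case
  proof (cases "v = u")
    case False
    then obtain w where w: "w \<in> neighbours G v" "graph_dist G u v = graph_dist G u w + 1"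
      using ex_neighbour_closer assms(1) less.prems by blast
    have "w \<in> verts G"
      using w neighbours_subset by blast
    then show ?thesis
      using less.hyps[of w] w graph_dist_neighbour[OF w(1)]
        graph_dist_triangle[of v w u] assms(1) less.prems by simp
  qed simp
qed

lemma ex_diametral_pair:
  "\<exists>x\<in>verts G. \<exists>y\<in>verts G. graph_dist G x y = graph_diameter G"
proof -
  have eq: "{graph_dist G u v |u v. u \<in> verts G \<and> v \<in> verts G}
      = (\<lambda>(u, v). graph_dist G u v) ` (verts G \<times> verts G)"
    by auto
  have "verts G \<noteq> {}"
    using two_vertices by auto
  then have "graph_diameter G \<in> (\<lambda>(u, v). graph_dist G u v) ` (verts G \<times> verts G)"
    unfolding graph_diameter_def eq by (intro Max_in) auto
  then show ?thesis
    by force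
qed

end

section \<open>A barrier for the midrange dynamics\<close>

text \<open>
  At time \<open>t\<close> and vertex \<open>v\<close> this is the sum of \<open>e\<^sup>k\<close> over all \<open>k \<ge> 0\<close> and all chains of times
  \<open>t \<ge> s\<^sub>1 > \<dots> > s\<^sub>k \<ge> 1\<close>, each with a walk \<open>v = v\<^sub>1, \<dots>, v\<^sub>k, v\<^sub>k\<^sub>+\<^sub>1\<close> such that \<open>u s\<^sub>i = v\<^sub>i\<close> for
  \<open>1 \<le> i \<le> k\<close>. The logarithm is an upper bound for the length of the longest chain.
\<close>

primrec chain_weight :: "('a, 'b) pre_digraph \<Rightarrow> (nat \<Rightarrow> 'a) \<Rightarrow> nat \<Rightarrow> 'a \<Rightarrow> real" where
  "chain_weight G u 0 = (\<lambda>_. 1)"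
| "chain_weight G u (Suc t) =
     (chain_weight G u t)
       (u (Suc t) := chain_weight G u t (u (Suc t))
          + exp 1 * (\<Sum>z\<in>neighbours G (u (Suc t)). chain_weight G u t z))"

lemma chain_weight_ge_1: "chain_weight G u t v \<ge> 1"
proof (induction t arbitrary: v)
  case (Suc t)
  have "0 \<le> exp 1 * (\<Sum>z\<in>neighbours G (u (Suc t)). chain_weight G u t z)"
    using Suc by (intro mult_nonneg_nonneg sum_nonneg) (auto intro: order_trans[OF zero_le_one])
  then show ?case
    using Suc[of v] by auto
qed simp

lemma chain_weight_nonneg: "chain_weight G u t v \<ge> 0"
  using chain_weight_ge_1[of G u t v] by linarith

lemma chain_weight_mono:
  assumes "s \<le> t"
  shows "chain_weight G u s v \<le> chain_weight G u t v"
proof -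
  have "chain_weight G u t v \<le> chain_weight G u (Suc t) v" for t
    by (auto intro!: mult_nonneg_nonneg sum_nonneg chain_weight_nonneg)
  then show ?thesis
    using assms lift_Suc_mono_le[of "\<lambda>t. chain_weight G u t v"] by blast
qed

lemma chain_weight_cong:
  assumes "\<And>i. 1 \<le> i \<Longrightarrow> i \<le> t \<Longrightarrow> u i = u' i"
  shows "chain_weight G u t = chain_weight G u' t"
  using assms by (induction t) simp_all

context connected_graph
begin

text \<open>
  The factor \<open>e\<close> in the recursion makes the logarithm behave like the longest-chain length: an update
  raises it to at least one more than its value at any neighbour, as it raises that length.
\<close>

lemma ln_chain_weight_neighbour:
  assumes "z \<in> neighbours G (u (Suc t))"
  shows "ln (chain_weight G u t z) + 1 \<le> ln (chain_weight G u (Suc t) (u (Suc t)))"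
proof -
  let ?w = "chain_weight G u t"
  have pos: "?w z > 0"
    using chain_weight_ge_1[of G u t z] by linarith
  have "exp 1 * ?w z \<le> exp 1 * (\<Sum>z\<in>neighbours G (u (Suc t)). ?w z)"
    using assms finite_neighbours chain_weight_nonneg[of G u t]
    by (intro mult_left_mono member_le_sum) auto
  also have "\<dots> \<le> chain_weight G u (Suc t) (u (Suc t))"
    using chain_weight_nonneg[of G u t] by simp
  finally have "ln (exp 1 * ?w z) \<le> ln (chain_weight G u (Suc t) (u (Suc t)))"
    using pos by (subst ln_le_cancel_iff) (auto intro: less_le_trans[rotated])
  then show ?thesis
    using pos by (simp add: ln_mult)
qed

lemma midrange_update_le:
  assumes z: "z \<in> neighbours G v" "f z \<le> a" and b: "\<And>w. w \<in> neighbours G v \<Longrightarrow> f w \<le> b"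
  shows "midrange_update G v f v \<le> (b + a) / 2"
proof -
  have "Max (f ` neighbours G v) \<le> b"
    using b z(1) finite_neighbours by (subst Max_le_iff) auto
  moreover have "Min (f ` neighbours G v) \<le> a"
    using z finite_neighbours by (intro Min.coboundedI[THEN order_trans]) auto
  ultimately show ?thesis
    by (simp add: midrange_update_def)
qed

text \<open>
  The midrange of the two bounds \<open>(i - 1)\<^sup>2\<close> and \<open>(i + 1)\<^sup>2\<close> for squared distances is \<open>i\<^sup>2 + 1\<close>, and the
  excess \<open>1\<close> is paid for by the increase of the logarithmic chain weight.
\<close>

lemma midrange_process_le_barrier:
  assumes x: "x \<in> verts G"
    and c: "c \<ge> 0"
    and f: "\<And>v. v \<in> verts G \<Longrightarrow> f v \<le> b + c * (real (graph_dist G x v))\<^sup>2"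
    and v: "v \<in> verts G"
  shows "midrange_process G f u t v
    \<le> b + c * ((real (graph_dist G x v))\<^sup>2 + ln (chain_weight G u t v))"
  using v
proof (induction t arbitrary: v)
  case 0
  then show ?case
    using f by simp
next
  case (Suc t)
  let ?d = "\<lambda>v. real (graph_dist G x v)"
  let ?f = "midrange_process G f u t"
  show ?case
  proof (cases "v = u (Suc t)")
    case False
    then show ?thesis
      using Suc by (simp add: midrange_update_def)
  next
    case True
    let ?k = "ln (chain_weight G u (Suc t) v)"
    have nb: "?f w \<le> b + c * (r\<^sup>2 + ?k - 1)"
      if w: "w \<in> neighbours G v" and r: "?d w \<le> r" for w r
    proof -
      have "?f w \<le> b + c * ((?d w)\<^sup>2 + ln (chain_weight G u t w))"
        using Suc.IH neighbours_subset w by blast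
      also have "\<dots> \<le> b + c * (r\<^sup>2 + (?k - 1))"
        using ln_chain_weight_neighbour[of w u t] w r c True
        by (intro add_left_mono mult_left_mono add_mono power_mono) auto
      finally show ?thesis
        by (simp add: algebra_simps)
    qed
    have far: "?f w \<le> b + c * ((?d v + 1)\<^sup>2 + ?k - 1)" if "w \<in> neighbours G v" for w
      using nb[OF that] graph_dist_step[OF x that] by simp
    \<comment> \<open>At \<open>v = x\<close> no neighbour is closer to \<open>x\<close>, but there \<open>(i - 1)\<^sup>2 = 1\<close> and any neighbour will do;
      the absolute value covers this case.\<close>
    obtain z where z: "z \<in> neighbours G v" "?d z \<le> \<bar>?d v - 1\<bar>"
    proof (cases "v = x")
      case True
      then show ?thesis
        using that neighbours_nonempty[OF x] graph_dist_neighbour[of _ x] graph_dist_refl[OF x]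
        by fastforce
    next
      case False
      then obtain z where "z \<in> neighbours G v" "graph_dist G x v = graph_dist G x z + 1"
        using ex_neighbour_closer[OF x Suc.prems] by blast
      then show ?thesis
        using that by simp
    qed
    have near: "?f z \<le> b + c * ((?d v - 1)\<^sup>2 + ?k - 1)"
      using nb[OF z] by simp
    have "midrange_process G f u (Suc t) v \<le>
        ((b + c * ((?d v + 1)\<^sup>2 + ?k - 1)) + (b + c * ((?d v - 1)\<^sup>2 + ?k - 1))) / 2"
      using midrange_update_le[of z v ?f, OF z(1) near far] True by simp
    also have "\<dots> = b + c * ((?d v)\<^sup>2 + ?k)"
      by (simp add: power2_eq_square algebra_simps add_divide_distrib)
    finally show ?thesis .
  qed
qed

text \<open>Negation exchanges maximum and minimum, so upper barriers turn into lower ones.\<close>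

lemma midrange_process_minus:
  assumes "\<And>s. 1 \<le> s \<Longrightarrow> u s \<in> verts G"
  shows "midrange_process G (\<lambda>v. - f v) u t = (\<lambda>v. - midrange_process G f u t v)"
proof (induction t)
  case (Suc t)
  let ?N = "neighbours G (u (Suc t))" and ?f = "midrange_process G f u t"
  have N: "finite (?f ` ?N)" "?f ` ?N \<noteq> {}"
    using finite_neighbours neighbours_nonempty assms by auto
  have "(\<lambda>v. - ?f v) ` ?N = uminus ` ?f ` ?N"
    by auto
  then have "Max ((\<lambda>v. - ?f v) ` ?N) = - Min (?f ` ?N)" "Min ((\<lambda>v. - ?f v) ` ?N) = - Max (?f ` ?N)"
    using minus_Min_eq_Max[OF N] minus_Max_eq_Min[OF N] by simp_all
  then show ?case
    unfolding midrange_process.simps Suc midrange_update_def by (auto simp: field_simps)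
qed simp

lemma midrange_process_ge_barrier:
  assumes u: "\<And>s. 1 \<le> s \<Longrightarrow> u s \<in> verts G"
    and x: "x \<in> verts G"
    and c: "c \<ge> 0"
    and f: "\<And>v. v \<in> verts G \<Longrightarrow> f v \<ge> b - c * (real (graph_dist G x v))\<^sup>2"
    and v: "v \<in> verts G"
  shows "midrange_process G f u t v
    \<ge> b - c * ((real (graph_dist G x v))\<^sup>2 + ln (chain_weight G u t v))"
proof -
  have "midrange_process G (\<lambda>v. - f v) u t v
      \<le> - b + c * ((real (graph_dist G x v))\<^sup>2 + ln (chain_weight G u t v))"
    using f by (intro midrange_process_le_barrier[OF x c _ v]) fastforce
  then show ?thesis
    using fun_cong[OF midrange_process_minus, of u f t v] u by fastforce
qed

text \<open>
  The upper barrier around \<open>x\<close> at time \<open>0\<close>, truncated at \<open>1\<close>. With the factor \<open>4 / D\<^sup>2\<close> this barrier and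
  the lower one around a vertex at distance \<open>D\<close> from \<open>x\<close> both vanish at distance \<open>D / 2\<close> from their
  centres, so they meet halfway without crossing.
\<close>

definition initial_profile :: "'a \<Rightarrow> 'a \<Rightarrow> real" where
  "initial_profile x v =
     min 1 (4 / (real (graph_diameter G))\<^sup>2 * (real (graph_dist G x v))\<^sup>2 - 1)"

lemma initial_profile_bounds: "initial_profile x v \<in> {-1..1}"
  by (auto simp: initial_profile_def)

text \<open>
  For \<open>a = d x v\<close> and \<open>b = d y v\<close> the triangle inequality gives \<open>a + b \<ge> D\<close>, hence
  \<open>a\<^sup>2 + b\<^sup>2 \<ge> D\<^sup>2 / 2\<close>.
\<close>

lemma initial_profile_ge:
  assumes xy: "x \<in> verts G" "y \<in> verts G" "graph_dist G x y = graph_diameter G"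
    and D: "graph_diameter G > 0" and v: "v \<in> verts G"
  shows "initial_profile x v
    \<ge> 1 - 4 / (real (graph_diameter G))\<^sup>2 * (real (graph_dist G y v))\<^sup>2"
proof -
  define a b D where "a = real (graph_dist G x v)" and "b = real (graph_dist G y v)"
    and "D = real (graph_diameter G)"
  have "D \<le> a + b"
    using graph_dist_triangle[of x v y] graph_dist_sym_le[of y v] xy v
    unfolding a_def b_def D_def by linarith
  moreover have Dpos: "D > 0"
    using D by (simp add: D_def)
  ultimately have "D\<^sup>2 \<le> (a + b)\<^sup>2"
    by (intro power_mono) auto
  also have "\<dots> \<le> 2 * (a\<^sup>2 + b\<^sup>2)"
    using sum_squares_bound[of a b] by (simp add: power2_sum)
  finally have "2 \<le> 4 / D\<^sup>2 * (a\<^sup>2 + b\<^sup>2)"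
    using Dpos by (simp add: field_simps)
  moreover have "0 \<le> 4 / D\<^sup>2 * b\<^sup>2"
    by simp
  ultimately show ?thesis
    unfolding initial_profile_def a_def[symmetric] b_def[symmetric] D_def[symmetric]
    by (simp add: distrib_left)
qed

text \<open>
  Both barriers have distance term \<open>0\<close> at their own centre, so the values at \<open>y\<close> and \<open>x\<close> differ by at
  least \<open>2 - 4 / D\<^sup>2 * (ln (W x) + ln (W y))\<close>. The hypothesis is stated for the sum of the weights
  because expectation is linear in it; the inequality of arithmetic and geometric means passes to the
  product.
\<close>

lemma osc_initial_profile_gt_1:
  assumes u: "\<And>s. 1 \<le> s \<Longrightarrow> u s \<in> verts G"
    and xy: "x \<in> verts G" "y \<in> verts G" "graph_dist G x y = graph_diameter G"
    and D: "graph_diameter G > 0"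
    and W: "chain_weight G u t x + chain_weight G u t y
              < 2 * exp ((real (graph_diameter G))\<^sup>2 / 8)"
  shows "osc G (midrange_process G (initial_profile x) u t) > 1"
proof -
  define D where "D = real (graph_diameter G)"
  have Dpos: "D > 0"
    using D by (simp add: D_def)
  let ?f = "midrange_process G (initial_profile x) u t"
  let ?X = "chain_weight G u t x" and ?Y = "chain_weight G u t y"
  have pos: "?X > 0" "?Y > 0"
    using chain_weight_ge_1[of G u t] less_le_trans[OF zero_less_one] by blast+
  have X: "?f x \<le> - 1 + 4 / D\<^sup>2 * ln ?X"
    using midrange_process_le_barrier[OF xy(1), where c = "4 / D\<^sup>2" and b = "- 1"
        and f = "initial_profile x" and v = x and u = u and t = t]
    by (simp add: initial_profile_def D_def graph_dist_refl xy)
  have Y: "?f y \<ge> 1 - 4 / D\<^sup>2 * ln ?Y"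
    using midrange_process_ge_barrier[where c = "4 / D\<^sup>2" and b = 1
        and f = "initial_profile x" and v = y and u = u and t = t, OF u xy(2)]
      initial_profile_ge[OF xy D]
    by (simp add: D_def graph_dist_refl xy)
  have "?X * ?Y \<le> ((?X + ?Y) / 2)\<^sup>2"
    using sum_squares_bound[of ?X ?Y] by (simp add: power2_eq_square field_simps)
  also have "\<dots> < (exp (D\<^sup>2 / 8))\<^sup>2"
    using W pos by (intro power_strict_mono) (auto simp: D_def)
  also have "\<dots> = exp (D\<^sup>2 / 4)"
    by (simp add: power2_eq_square flip: exp_add)
  finally have "ln (?X * ?Y) < D\<^sup>2 / 4"
    using pos by (metis exp_less_cancel_iff exp_ln mult_pos_pos)
  then have "ln ?X + ln ?Y < D\<^sup>2 / 4"
    using pos by (simp add: ln_mult)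
  then have "4 / D\<^sup>2 * (ln ?X + ln ?Y) < 1"
    using Dpos by (simp add: field_simps)
  then have "1 < ?f y - ?f x"
    using X Y unfolding distrib_left by linarith
  also have "\<dots> \<le> osc G ?f"
    unfolding osc_def using xy by (intro diff_mono Max_ge Min_le) auto
  finally show ?thesis .
qed

section \<open>Growth of the expected chain weight\<close>

text \<open>
  The weight at time \<open>t\<close> is a function of the first \<open>t\<close> updated vertices, which range over a finite
  space: it is therefore bounded and measurable, and independent of the next updated vertex.
\<close>

lemma
  fixes M :: "'w measure"
  assumes U: "iid_uniform_vertices G M U"
  shows integrable_chain_weight: "integrable M (\<lambda>\<omega>. chain_weight G (\<lambda>i. U i \<omega>) t v)" (is ?int)
    and expectation_update_chain_weight: "w \<in> verts G \<Longrightarrow>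
      (\<integral>\<omega>. chain_weight G (\<lambda>i. U i \<omega>) t v * indicator {w} (U (Suc t) \<omega>) \<partial>M) =
        (\<integral>\<omega>. chain_weight G (\<lambda>i. U i \<omega>) t v \<partial>M) / card (verts G)" (is "_ \<Longrightarrow> ?eq")
    and integrable_update_chain_weight:
      "integrable M (\<lambda>\<omega>. chain_weight G (\<lambda>i. U i \<omega>) t v * indicator {w} (U (Suc t) \<omega>))" (is ?int')
proof -
  interpret prob_space M
    using U by (simp add: iid_uniform_vertices_def)
  let ?V = "\<lambda>_::nat. count_space (verts G)"
  let ?X = "\<lambda>A \<omega>. \<lambda>i\<in>A. U i \<omega>"
  let ?W = "\<lambda>p. chain_weight G p t v"
  let ?I = "\<lambda>p. indicator {w} (p (Suc t)) :: real"
  have ind: "indep_vars ?V U {1..}"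
    using U by (simp add: iid_uniform_vertices_def)
  then have meas: "random_variable (count_space (verts G)) (U i)" if "1 \<le> i" for i
    using that by (auto simp: indep_vars_def)
  have PiM: "PiM A ?V = count_space (A \<rightarrow>\<^sub>E verts G)" if "finite A" for A
    using that by (intro count_space_PiM_finite) (auto intro: countable_finite)
  have W: "chain_weight G (\<lambda>i. U i \<omega>) t v = (?W \<circ> ?X {1..t}) \<omega>" for \<omega>
    unfolding comp_def by (rule fun_cong[OF chain_weight_cong]) simp
  have I: "indicator {w} (U (Suc t) \<omega>) = (?I \<circ> ?X {Suc t}) \<omega>" for \<omega>
    by simp
  have "indep_var (PiM {1..t} ?V) (?X {1..t}) (PiM {Suc t} ?V) (?X {Suc t})"
    by (rule indep_var_restrict[OF ind]) auto
  then have indep: "indep_var borel (?W \<circ> ?X {1..t}) borel (?I \<circ> ?X {Suc t})"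
    by (rule indep_var_compose) (simp_all add: PiM)
  have space: "?X {1..t} \<omega> \<in> {1..t} \<rightarrow>\<^sub>E verts G" if "\<omega> \<in> space M" for \<omega>
    using measurable_space[OF meas that] by auto
  have "finite (?W ` ({1..t} \<rightarrow>\<^sub>E verts G))"
    by (intro finite_imageI finite_PiE) auto
  then obtain B where B: "\<And>p. p \<in> {1..t} \<rightarrow>\<^sub>E verts G \<Longrightarrow> norm (?W p) \<le> B"
    using finite_imp_bounded[THEN bounded_iff[THEN iffD1]] by (metis imageI)
  have int: "integrable M (?W \<circ> ?X {1..t})"
    using indep B space
    by (intro integrable_const_bound[of _ B]) (auto dest: indep_var_rv1)
  then show ?int
    unfolding W .
  have int_I: "integrable M (?I \<circ> ?X {Suc t})"
    using indep by (intro integrable_const_bound[of _ 1]) (auto dest: indep_var_rv2)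
  show ?int'
    unfolding W I by (rule indep_var_integrable[OF indep int int_I])
  show ?eq if w: "w \<in> verts G"
  proof -
    have "expectation (?I \<circ> ?X {Suc t}) = expectation (indicator (U (Suc t) -` {w} \<inter> space M))"
      by (intro Bochner_Integration.integral_cong) (auto split: split_indicator)
    also have "\<dots> = prob (U (Suc t) -` {w} \<inter> space M)"
      by simp
    also have "\<dots> = measure (distr M (count_space (verts G)) (U (Suc t))) {w}"
      using w meas by (subst measure_distr) auto
    also have "\<dots> = 1 / card (verts G)"
      using w U by (simp add: iid_uniform_vertices_def measure_uniform_count_measure)
    finally have E: "expectation (?I \<circ> ?X {Suc t}) = 1 / card (verts G)" .
    show ?thesis
      unfolding W I
      by (simp only: indep_var_lebesgue_integral[OF indep int int_I] E) simp
  qed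
qed

text \<open>
  In expectation, one step adds to the weight at \<open>v\<close> the fraction \<open>e / n\<close> of the weights at the at most
  \<open>\<Delta>\<close> neighbours of \<open>v\<close>.
\<close>

lemma expectation_chain_weight_le:
  fixes M :: "'w measure"
  assumes U: "iid_uniform_vertices G M U" and v: "v \<in> verts G"
  shows "(\<integral>\<omega>. chain_weight G (\<lambda>i. U i \<omega>) t v \<partial>M)
    \<le> (1 + exp 1 * real (max_degree G) / real (card (verts G))) ^ t"
  using v
proof (induction t arbitrary: v)
  case 0
  interpret prob_space M
    using U by (simp add: iid_uniform_vertices_def)
  show ?case
    by (simp add: prob_space)
next
  case (Suc t)
  let ?W = "\<lambda>t v \<omega>. chain_weight G (\<lambda>i. U i \<omega>) t v"
  let ?n = "real (card (verts G))" and ?E = "\<lambda>t v. \<integral>\<omega>. ?W t v \<omega> \<partial>M"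
  define m where "m = (1 + exp 1 * real (max_degree G) / ?n) ^ t"
  have "?W (Suc t) v \<omega> =
      ?W t v \<omega> + exp 1 * (\<Sum>z\<in>neighbours G v. ?W t z \<omega> * indicator {v} (U (Suc t) \<omega>))" for \<omega>
    by simp
  then have "?E (Suc t) v = ?E t v + exp 1 * (\<Sum>z\<in>neighbours G v. ?E t z / ?n)"
    using integrable_chain_weight[OF U] integrable_update_chain_weight[OF U]
      expectation_update_chain_weight[OF U Suc.prems]
    by (simp add: Bochner_Integration.integral_add Bochner_Integration.integral_sum
        del: chain_weight.simps)
  also have "\<dots> \<le> m + exp 1 * (\<Sum>z\<in>neighbours G v. m / ?n)"
    using Suc neighbours_subset unfolding m_def
    by (intro add_mono mult_left_mono sum_mono divide_right_mono) auto
  also have "\<dots> \<le> m + exp 1 * (real (max_degree G) * (m / ?n))"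
    using card_neighbours_le[OF Suc.prems] unfolding sum_constant
    by (intro add_left_mono mult_left_mono mult_right_mono) (auto simp: m_def)
  finally show ?case
    by (simp add: m_def algebra_simps)
qed

text \<open>
  Markov's inequality is applied after subtracting the initial weight \<open>1\<close> at each of the two vertices.
  With \<open>q = e\<^sup>a\<close> the resulting bound is \<open>(q - 1) / (q\<^sup>2 - 1) = 1 / (q + 1) \<le> 1 / 2\<close>, uniformly in \<open>a\<close>;
  without the subtraction it would be \<open>1 / q\<close>, which is useless for small diameters.
\<close>

lemma prob_chain_weight_small:
  fixes M :: "'w measure"
  assumes U: "iid_uniform_vertices G M U"
    and xy: "x \<in> verts G" "y \<in> verts G" "a > 0"
    and t: "exp 1 * real (max_degree G) / real (card (verts G)) * real t \<le> a"
  shows "measure M {\<omega>\<in>space M. chain_weight G (\<lambda>i. U i \<omega>) t x + chain_weight G (\<lambda>i. U i \<omega>) t y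
            < 2 * exp (2 * a)} \<ge> 1 / 2"
proof -
  interpret prob_space M
    using U by (simp add: iid_uniform_vertices_def)
  let ?W = "\<lambda>v \<omega>. chain_weight G (\<lambda>i. U i \<omega>) t v"
  let ?S = "\<lambda>\<omega>. ?W x \<omega> + ?W y \<omega> - 2"
  note int[intro, simp] = integrable_chain_weight[OF U]
  note [measurable] = borel_measurable_integrable[OF int]
  let ?b = "exp 1 * real (max_degree G) / real (card (verts G))"
  have "(1 + ?b) ^ t \<le> exp ?b ^ t"
    by (intro power_mono exp_ge_add_one_self) auto
  also have "\<dots> = exp (?b * real t)"
    by (simp only: exp_of_nat2_mult)
  also have "\<dots> \<le> exp a"
    using t by simp
  finally have "expectation (?W v) \<le> exp a" if "v \<in> verts G" for v
    using expectation_chain_weight_le[OF U that, of t] by linarith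
  then have E: "expectation ?S \<le> 2 * (exp a - 1)"
    using add_mono[of "expectation (?W x)" "exp a" "expectation (?W y)" "exp a"] xy
    by (simp add: prob_space)
  have q: "exp (2 * a) = exp a * exp a"
    by (simp flip: exp_add)
  have Q: "0 < 2 * (exp (2 * a) - 1)"
    using xy by simp
  have ge: "2 \<le> ?W x \<omega> + ?W y \<omega>" for \<omega>
    using add_mono[OF chain_weight_ge_1 chain_weight_ge_1] by (metis one_add_one)
  have "prob {\<omega>\<in>space M. 2 * (exp (2 * a) - 1) \<le> ?S \<omega>} \<le> expectation ?S / (2 * (exp (2 * a) - 1))"
    using ge Q by (intro integral_Markov_inequality_measure[where A = "{}"]) auto
  also have "\<dots> \<le> (2 * (exp a - 1)) / (2 * (exp (2 * a) - 1))"
    using E Q by (intro divide_right_mono) auto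
  also have "\<dots> \<le> 1 / 2"
  proof -
    have "2 * (exp a - 1) \<le> exp (2 * a) - 1"
      using zero_le_square[of "exp a - 1"] unfolding q by (simp add: algebra_simps)
    then show ?thesis
      using Q by (simp add: divide_le_eq)
  qed
  finally have "prob {\<omega>\<in>space M. 2 * (exp (2 * a) - 1) \<le> ?S \<omega>} \<le> 1 / 2" .
  moreover have "{\<omega>\<in>space M. ?W x \<omega> + ?W y \<omega> < 2 * exp (2 * a)}
      = space M - {\<omega>\<in>space M. 2 * (exp (2 * a) - 1) \<le> ?S \<omega>}"
    by (auto simp: algebra_simps)
  ultimately show ?thesis
    by (simp add: prob_compl)
qed

section \<open>The lower bound\<close>

text \<open>The chain weights increase with time, so a bound at time \<open>t\<close> controls all earlier times.\<close>

lemma hitting_time_initial_profile_ge: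
  assumes u: "\<And>s. 1 \<le> s \<Longrightarrow> u s \<in> verts G"
    and xy: "x \<in> verts G" "y \<in> verts G" "graph_dist G x y = graph_diameter G"
    and D: "graph_diameter G > 0" and \<epsilon>: "\<epsilon> \<le> 1"
    and W: "chain_weight G u t x + chain_weight G u t y
              < 2 * exp ((real (graph_diameter G))\<^sup>2 / 8)"
  shows "enat (Suc t) \<le> hitting_time G \<epsilon> (initial_profile x) u"
proof -
  have "Suc t \<le> s" if s: "osc G (midrange_process G (initial_profile x) u s) \<le> \<epsilon>" for s
  proof (rule ccontr)
    assume "\<not> Suc t \<le> s"
    then have "s \<le> t"
      by simp
    then have "chain_weight G u s x + chain_weight G u s y
        < 2 * exp ((real (graph_diameter G))\<^sup>2 / 8)"
      using chain_weight_mono[of s t G u] W by (smt (verit))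
    from osc_initial_profile_gt_1[OF u xy D this] s \<epsilon> show False
      by simp
  qed
  then show ?thesis
    unfolding hitting_time_def by (auto intro!: Inf_greatest)
qed

lemma expected_hitting_time_ge:
  fixes M :: "'w measure"
  assumes U: "iid_uniform_vertices G M U"
    and xy: "x \<in> verts G" "y \<in> verts G" "graph_dist G x y = graph_diameter G"
    and D: "graph_diameter G > 0" and \<epsilon>: "\<epsilon> \<le> 1"
  shows "(\<integral>\<^sup>+\<omega>. ennreal_of_enat (hitting_time G \<epsilon> (initial_profile x) (\<lambda>t. U t \<omega>)) \<partial>M)
    \<ge> ennreal (1 / (32 * exp 1) *
         (real (card (verts G)) * (real (graph_diameter G))\<^sup>2 / real (max_degree G)))"
proof -
  interpret prob_space M
    using U by (simp add: iid_uniform_vertices_def)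
  \<comment> \<open>The value of \<open>a\<close> makes the threshold \<open>2 exp (2 a)\<close> of the probability estimate equal to the
    threshold \<open>2 exp (D\<^sup>2 / 8)\<close> below which the oscillation exceeds \<open>1\<close>.\<close>
  define a where "a = (real (graph_diameter G))\<^sup>2 / 16"
  define b where "b = exp 1 * real (max_degree G) / real (card (verts G))"
  define t where "t = nat \<lfloor>a / b\<rfloor>"
  let ?W = "\<lambda>v \<omega>. chain_weight G (\<lambda>i. U i \<omega>) t v"
  define A where "A = {\<omega>\<in>space M. ?W x \<omega> + ?W y \<omega> < 2 * exp (2 * a)}"
  have a: "a > 0" and b: "b \<ge> 0"
    using D by (simp_all add: a_def b_def)
  then have t: "real t \<le> a / b" "a / b \<le> real (Suc t)"
    unfolding t_def by (simp_all add: of_nat_floor) linarith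
  have "b * real t \<le> a"
    using t a b by (cases "b = 0") (simp_all add: field_simps)
  then have "prob A \<ge> 1 / 2"
    unfolding A_def b_def using prob_chain_weight_small[OF U xy(1,2) a] by blast
  have [measurable]: "A \<in> sets M"
    unfolding A_def using borel_measurable_integrable[OF integrable_chain_weight[OF U]] by measurable
  have meas: "U i \<in> measurable M (count_space (verts G))" if "1 \<le> i" for i
    using U that by (auto simp: iid_uniform_vertices_def indep_vars_def)
  have le: "ennreal (real (Suc t)) * indicator A \<omega>
      \<le> ennreal_of_enat (hitting_time G \<epsilon> (initial_profile x) (\<lambda>t. U t \<omega>))"
    if "\<omega> \<in> space M" for \<omega>
  proof (cases "\<omega> \<in> A")
    case True
    then have "enat (Suc t) \<le> hitting_time G \<epsilon> (initial_profile x) (\<lambda>t. U t \<omega>)"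
      using measurable_space[OF meas that] D \<epsilon>
      by (intro hitting_time_initial_profile_ge[OF _ xy]) (auto simp: A_def a_def)
    then have "ennreal_of_enat (enat (Suc t))
        \<le> ennreal_of_enat (hitting_time G \<epsilon> (initial_profile x) (\<lambda>t. U t \<omega>))"
      by (subst ennreal_of_enat_le_iff)
    then show ?thesis
      using True by (simp add: ennreal_of_nat_eq_real_of_nat del: of_nat_Suc)
  qed simp
  have "1 / (32 * exp 1) *
         (real (card (verts G)) * (real (graph_diameter G))\<^sup>2 / real (max_degree G)) = a / b * (1 / 2)"
    by (simp add: a_def b_def mult.assoc mult.commute mult.left_commute)
  also have "\<dots> \<le> real (Suc t) * prob A"
    using t \<open>prob A \<ge> 1 / 2\<close> by (intro mult_mono) auto
  finally have "ennreal (1 / (32 * exp 1) *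
         (real (card (verts G)) * (real (graph_diameter G))\<^sup>2 / real (max_degree G)))
      \<le> ennreal (real (Suc t)) * emeasure M A"
    by (simp add: emeasure_eq_measure ennreal_leI flip: ennreal_mult del: of_nat_Suc)
  also have "\<dots> = (\<integral>\<^sup>+\<omega>. ennreal (real (Suc t)) * indicator A \<omega> \<partial>M)"
    by (simp add: nn_integral_cmult_indicator)
  also have "\<dots> \<le> (\<integral>\<^sup>+\<omega>. ennreal_of_enat (hitting_time G \<epsilon> (initial_profile x) (\<lambda>t. U t \<omega>)) \<partial>M)"
    by (intro nn_integral_mono le)
  finally show ?thesis .
qed

end

theorem theorem5p3:
  fixes G :: "('a, 'b) pre_digraph"
  assumes "graph G"
    and "Digraph_Component.connected G"
    and "card (verts G) \<ge> 2"
  shows "\<exists>f\<^sub>0 \<in> verts G \<rightarrow> {-1..1}.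
           \<forall>\<epsilon>::real. 0 < \<epsilon> \<and> \<epsilon> \<le> 1 \<longrightarrow>
             (\<forall>(M :: 'w measure) U. iid_uniform_vertices G M U \<longrightarrow>
                (\<integral>\<^sup>+\<omega>. ennreal_of_enat (hitting_time G \<epsilon> f\<^sub>0 (\<lambda>t. U t \<omega>)) \<partial>M)
                  \<ge> ennreal (1 / (16 * exp 1 * pi\<^sup>2) *
                      (real (card (verts G)) * (real (graph_diameter G))\<^sup>2 / real (max_degree G))))"
proof -
  interpret connected_graph G
    using assms by (simp add: connected_graph_def connected_graph_axioms_def)
  obtain x y where xy: "x \<in> verts G" "y \<in> verts G" "graph_dist G x y = graph_diameter G"
    using ex_diametral_pair by blast
  have "2\<^sup>2 \<le> pi\<^sup>2"
    using pi_ge_two by (intro power_mono) auto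
  then have "1 / (16 * exp 1 * pi\<^sup>2) \<le> 1 / (32 * exp 1)"
    by (intro divide_left_mono) auto
  then have const: "1 / (16 * exp 1 * pi\<^sup>2) * r \<le> 1 / (32 * exp 1) * r" if "r \<ge> 0" for r
    using that by (rule mult_right_mono)
  show ?thesis
  proof (intro bexI[of _ "initial_profile x"] allI impI)
    fix \<epsilon> :: real and M :: "'w measure" and U
    assume \<epsilon>: "0 < \<epsilon> \<and> \<epsilon> \<le> 1" and U: "iid_uniform_vertices G M U"
    let ?r = "real (card (verts G)) * (real (graph_diameter G))\<^sup>2 / real (max_degree G)"
    show "ennreal (1 / (16 * exp 1 * pi\<^sup>2) * ?r)
      \<le> (\<integral>\<^sup>+\<omega>. ennreal_of_enat (hitting_time G \<epsilon> (initial_profile x) (\<lambda>t. U t \<omega>)) \<partial>M)"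
    proof (cases "graph_diameter G = 0")
      case False
      have "ennreal (1 / (16 * exp 1 * pi\<^sup>2) * ?r) \<le> ennreal (1 / (32 * exp 1) * ?r)"
        by (intro ennreal_leI const) auto
      also have "\<dots> \<le> (\<integral>\<^sup>+\<omega>. ennreal_of_enat
          (hitting_time G \<epsilon> (initial_profile x) (\<lambda>t. U t \<omega>)) \<partial>M)"
        using False \<epsilon> by (intro expected_hitting_time_ge[OF U xy]) auto
      finally show ?thesis .
    qed simp
  qed (use initial_profile_bounds in auto)
qed

end
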